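(* Let $T>0$, $\alpha>0$, let $W\subset\mathbb{Z}$ be a finite set, and let $j:L^2(0,T)\to\mathbb{R}$ be continuous. Let $(\eta_\varepsilon)_{\varepsilon>0}$ be a family of positive mollifiers, let $K_\varepsilon(w)=r_{[0,T]}(\eta_\varepsilon * w)$ be the associated convolution operator and let $j_\varepsilon=j\circ K_\varepsilon$. Let $(\varepsilon^n)_{n\in\mathbb{N}}$ be a sequence of positive numbers with $\varepsilon^n\to 0$. Then the sequence of functionals $\hat j_{\varepsilon^n}:=j_{\varepsilon^n}+\alpha\,\mathrm{TV}$ $\Gamma$-converges to $\hat j:=j+\alpha\,\mathrm{TV}$ on $\mathrm{BV}_W(0,T)$, both with respect to weak-$^*$ convergence and with respect to strict convergence in $\mathrm{BV}_W(0,T)$.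
   Context: Total variation: for $f\in L^1(0,T)$, $\mathrm{TV}(f)=\sup\{\int_0^T f\phi'\,dt : \phi\in C_c^1(0,T),\ \sup_{s\in(0,T)}|\phi(s)|\le 1\}$, and $\mathrm{BV}(0,T)=\{f\in L^1(0,T): \mathrm{TV}(f)<\infty\}$. $\mathrm{BV}_W(0,T)=\{w\in\mathrm{BV}(0,T): w(t)\in W \text{ for a.a. } t\in[0,T]\}$. A sequence $(w^n)\subset \mathrm{BV}(0,T)$ converges weakly-$^*$ to $w\in\mathrm{BV}(0,T)$ if $w^n\to w$ in $L^1(0,T)$ and $\limsup_n \mathrm{TV}(w^n)<\infty$; it converges strictly to $w$ if in addition $\mathrm{TV}(w^n)\to\mathrm{TV}(w)$. Positive mollifiers: $\eta_\varepsilon(t)=\varepsilon^{-1}\eta(t/\varepsilon)$ with the usual kernel $\eta\in C_c^\infty(\mathbb{R})$, $\eta\ge 0$, $\int_{\mathbb{R}}\eta=1$, $\operatorname{supp}\eta\subset[-1,1]$. In $\eta_\varepsilon*w$ the function $w\in L^1(0,T)$ is extended by $0$ outside $[0,T]$; $r_{[0,T]}$ denotes restriction of a function on $\mathbb{R}$ to $[0,T]$. Thus $K_\varepsilon:L^1(0,T)\to L^2(0,T)$. $\Gamma$-convergence of $F_n$ to $F$ on $\mathrm{BV}_W(0,T)$ with respect to a notion of sequential convergence means: (lower bound) for every $w\in\mathrm{BV}_W(0,T)$ and every sequence $w^n\to w$ in $\mathrm{BV}_W(0,T)$ in this sense, $F(w)\le\liminf_n F_n(w^n)$; (upper bound) for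 every $w\in\mathrm{BV}_W(0,T)$ there is a sequence $w^n\to w$ in $\mathrm{BV}_W(0,T)$ in this sense with $\limsup_n F_n(w^n)\le F(w)$. *)

theory Defs
  imports "HOL-Analysis.Analysis"
begin

text \<open>
  Elements of \<open>L\<^sup>1(0,T)\<close> and \<open>L\<^sup>2(0,T)\<close> are represented by functions on the reals, of which
  only the values on \<open>(0,T)\<close> matter, and only up to null sets.
\<close>

definition L1 :: "real \<Rightarrow> (real \<Rightarrow> real) set" where
  "L1 T = {f. integrable (lebesgue_on {0<..<T}) f}"

definition L1_dist :: "real \<Rightarrow> (real \<Rightarrow> real) \<Rightarrow> (real \<Rightarrow> real) \<Rightarrow> real" where
  "L1_dist T f g = (LINT t|lebesgue_on {0<..<T}. \<bar>f t - g t\<bar>)"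

definition L2 :: "real \<Rightarrow> (real \<Rightarrow> real) set" where
  "L2 T = {f \<in> borel_measurable (lebesgue_on {0<..<T}).
             integrable (lebesgue_on {0<..<T}) (\<lambda>t. (f t)\<^sup>2)}"

definition L2_dist :: "real \<Rightarrow> (real \<Rightarrow> real) \<Rightarrow> (real \<Rightarrow> real) \<Rightarrow> real" where
  "L2_dist T f g = sqrt (LINT t|lebesgue_on {0<..<T}. (f t - g t)\<^sup>2)"

text \<open>
  Since \<open>L2_dist\<close> is only a pseudometric on functions, continuity with respect to it forces \<open>j\<close> to
  agree on functions that are equal almost everywhere (lemma \<open>continuous_on_L2_cong_AE\<close> below).
  Hence the \<open>j\<close> below are exactly the continuous functionals on the space of classes
  \<open>L\<^sup>2(0,T)\<close>.
\<close>

definition continuous_on_L2 :: "real \<Rightarrow> ((real \<Rightarrow> real) \<Rightarrow> real) \<Rightarrow> bool" where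
  "continuous_on_L2 T j \<longleftrightarrow>
     (\<forall>f\<in>L2 T. \<forall>e>0. \<exists>d>0. \<forall>g\<in>L2 T. L2_dist T g f < d \<longrightarrow> \<bar>j g - j f\<bar> < e)"

lemma continuous_on_L2_cong_AE:
  assumes "continuous_on_L2 T j" "f \<in> L2 T" "g \<in> L2 T"
    and "AE t in lebesgue_on {0<..<T}. f t = g t"
  shows "j f = j g"
proof (rule ccontr)
  assume ne: "j f \<noteq> j g"
  have "(LINT t|lebesgue_on {0<..<T}. (g t - f t)\<^sup>2) = 0"
    by (rule integral_eq_zero_AE) (use assms(4) in eventually_elim, simp)
  hence "L2_dist T g f = 0"
    by (simp add: L2_dist_def)
  moreover obtain d where "d > 0" "\<forall>g\<in>L2 T. L2_dist T g f < d \<longrightarrow> \<bar>j g - j f\<bar> < \<bar>j g - j f\<bar>"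
    using assms(1,2) ne unfolding continuous_on_L2_def
    by (metis assms(3) calculation less_irrefl zero_less_abs_iff right_minus_eq)
  ultimately show False
    using assms(3) by auto
qed

definition fun_support :: "(real \<Rightarrow> real) \<Rightarrow> real set" where
  "fun_support f = closure {x. f x \<noteq> 0}"

text \<open>
  A test function on \<open>(0,T)\<close> is identified with its extension by zero; a closed subset of \<open>(0,T)\<close>
  is automatically bounded, so the support condition says that the support is a compact subset of
  \<open>(0,T)\<close>.
\<close>

definition test_functions :: "real \<Rightarrow> (real \<Rightarrow> real) set" where
  "test_functions T = {\<phi>. \<phi> C1_differentiable_on UNIV \<and> fun_support \<phi> \<subseteq> {0<..<T}}"

definition TV :: "real \<Rightarrow> (real \<Rightarrow> real) \<Rightarrow> ereal" where
  "TV T f = (SUP \<phi> \<in> {\<phi> \<in> test_functions T. \<forall>s\<in>{0<..<T}. \<bar>\<phi> s\<bar> \<le> 1}.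
               ereal (LINT t|lebesgue_on {0<..<T}. f t * deriv \<phi> t))"

definition BV :: "real \<Rightarrow> (real \<Rightarrow> real) set" where
  "BV T = {f \<in> L1 T. TV T f < \<infinity>}"

definition BV_in :: "int set \<Rightarrow> real \<Rightarrow> (real \<Rightarrow> real) set" where
  "BV_in W T = {w \<in> BV T. AE t in lebesgue_on {0..T}. w t \<in> real_of_int ` W}"

definition weak_star_conv :: "real \<Rightarrow> (nat \<Rightarrow> real \<Rightarrow> real) \<Rightarrow> (real \<Rightarrow> real) \<Rightarrow> bool" where
  "weak_star_conv T w v \<longleftrightarrow> (\<forall>n. w n \<in> BV T) \<and> v \<in> BV T \<and>
     (\<lambda>n. L1_dist T (w n) v) \<longlonglongrightarrow> 0 \<and> limsup (\<lambda>n. TV T (w n)) < \<infinity>"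

definition strict_conv :: "real \<Rightarrow> (nat \<Rightarrow> real \<Rightarrow> real) \<Rightarrow> (real \<Rightarrow> real) \<Rightarrow> bool" where
  "strict_conv T w v \<longleftrightarrow> weak_star_conv T w v \<and> (\<lambda>n. TV T (w n)) \<longlonglongrightarrow> TV T v"

definition Gamma_converges_on ::
  "'a set \<Rightarrow> ((nat \<Rightarrow> 'a) \<Rightarrow> 'a \<Rightarrow> bool) \<Rightarrow> (nat \<Rightarrow> 'a \<Rightarrow> ereal) \<Rightarrow> ('a \<Rightarrow> ereal) \<Rightarrow> bool" where
  "Gamma_converges_on X conv F G \<longleftrightarrow>
     (\<forall>w\<in>X. \<forall>u. (\<forall>n. u n \<in> X) \<and> conv u w \<longrightarrow> G w \<le> liminf (\<lambda>n. F n (u n))) \<and>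
     (\<forall>w\<in>X. \<exists>u. (\<forall>n. u n \<in> X) \<and> conv u w \<and> limsup (\<lambda>n. F n (u n)) \<le> G w)"

definition mollifier_kernel :: "(real \<Rightarrow> real) \<Rightarrow> bool" where
  "mollifier_kernel \<eta> \<longleftrightarrow>
     (\<forall>k x. (deriv ^^ k) \<eta> differentiable (at x)) \<and> fun_support \<eta> \<subseteq> {-1..1} \<and>
     (\<forall>x. \<eta> x \<ge> 0) \<and> integral\<^sup>L lebesgue \<eta> = 1"

definition mollifier :: "(real \<Rightarrow> real) \<Rightarrow> real \<Rightarrow> real \<Rightarrow> real" where
  "mollifier \<eta> \<epsilon> t = \<eta> (t / \<epsilon>) / \<epsilon>"

definition zero_extension :: "real \<Rightarrow> (real \<Rightarrow> real) \<Rightarrow> real \<Rightarrow> real" where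
  "zero_extension T w t = (if t \<in> {0..T} then w t else 0)"

definition convolution :: "(real \<Rightarrow> real) \<Rightarrow> (real \<Rightarrow> real) \<Rightarrow> real \<Rightarrow> real" where
  "convolution f g t = (LINT s|lebesgue. f (t - s) * g s)"

definition conv_op :: "(real \<Rightarrow> real) \<Rightarrow> real \<Rightarrow> real \<Rightarrow> (real \<Rightarrow> real) \<Rightarrow> real \<Rightarrow> real" where
  "conv_op \<eta> T \<epsilon> w = restrict (convolution (mollifier \<eta> \<epsilon>) (zero_extension T w)) {0..T}"

definition TV_regularized ::
  "real \<Rightarrow> real \<Rightarrow> ((real \<Rightarrow> real) \<Rightarrow> real) \<Rightarrow> (real \<Rightarrow> real) \<Rightarrow> ereal" where
  "TV_regularized T \<alpha> j w = ereal (j w) + ereal \<alpha> * TV T w"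

end

theory Submission
  imports Defs
begin

text \<open>
  Elements of \<open>BV_in W T\<close> share a uniform bound \<open>M\<close>, because \<open>W\<close> is finite. Convolution with a
  mollifier does not increase the \<open>L\<^sup>1\<close> norm and preserves the bound \<open>M\<close>, so \<open>w\<^sup>n \<rightarrow> w\<close> in \<open>L\<^sup>1\<close>
  gives \<open>K\<^sub>\<epsilon> w\<^sup>n \<rightarrow> w\<close> first in \<open>L\<^sup>1\<close> (by comparison with a continuous function) and then in
  \<open>L\<^sup>2\<close>, since \<open>\<bar>f - g\<bar>\<^sup>2 \<le> 2M \<bar>f - g\<bar>\<close>. Hence the \<open>j\<close>-terms converge, the lower bound is the
  lower semicontinuity of \<open>TV\<close>, and constant sequences are recovery sequences.
\<close>

section \<open>Convolution with a compactly supported probability density\<close>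

text \<open>This is a kernel at one fixed scale, with \<open>r\<close> bounding the radius of its
  support. A mollifying sequence becomes a sequence of instances whose radii tend to 0.\<close>

locale averaging_kernel =
  fixes k :: "real \<Rightarrow> real" and r :: real
  assumes cont: "continuous_on UNIV k"
    and nonneg: "\<And>x. 0 \<le> k x"
    and support: "\<And>x. r < \<bar>x\<bar> \<Longrightarrow> k x = 0"
    and integral_1: "integral\<^sup>L lebesgue k = 1"
begin

lemma borel [measurable]: "k \<in> borel_measurable borel"
  using cont by (rule borel_measurable_continuous_onI)

lemma bounded: obtains B where "\<And>x. k x \<le> B"
proof -
  have "continuous_on {-r..r} k"
    using cont by (rule continuous_on_subset) simp
  then have "bounded (k ` {-r..r})"
    by (intro compact_imp_bounded compact_continuous_image compact_Icc)
  then obtain B where B: "\<forall>x\<in>{-r..r}. norm (k x) \<le> B"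
    by (auto simp: bounded_iff)
  have "k x \<le> max B 0" for x
  proof (cases "r < \<bar>x\<bar>")
    case True
    then show ?thesis by (simp add: support)
  next
    case False
    then have "norm (k x) \<le> B" by (intro B[rule_format]) auto
    then have "k x \<le> B" by simp
    then show ?thesis by simp
  qed
  then show ?thesis using that by blast
qed

text \<open>The Bochner integral of a non-integrable function is 0 by convention, so the value 1
  forces integrability.\<close>

lemma integrable_lborel: "integrable lborel k"
proof (rule ccontr)
  assume "\<not> integrable lborel k"
  then have "integral\<^sup>L lborel k = 0" by (rule not_integrable_integral_eq)
  then show False using integral_1 by (simp add: integral_completion)
qed

lemma translate_integral: "(LINT s|lborel. k (t - s)) = 1"
  using lborel_integral_real_affine[of "-1" k t] integral_1 by (simp add: integral_completion)

lemma translate_integrable: "integrable lborel (\<lambda>s. k (t - s))"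
  using lborel_integrable_real_affine[OF integrable_lborel, of "-1" t] by simp

text \<open>In contrast to \<open>translate_integral\<close>, the integration runs over
  \<open>t\<close> with \<open>s\<close> fixed. This is the inner integral that remains after
  Tonelli's theorem in the proof of \<open>convolution_L1_le\<close>.\<close>

lemma translate_nn_integral: "(\<integral>\<^sup>+t. ennreal (k (t - s)) \<partial>lborel) = 1"
proof -
  have "(\<integral>\<^sup>+t. ennreal (k (t - s)) \<partial>lborel) = (\<integral>\<^sup>+t. ennreal (k t) \<partial>lborel)"
    using nn_integral_real_affine[of "\<lambda>t. ennreal (k t)" 1 "-s"] by simp
  also have "\<dots> = 1"
    using nn_integral_eq_integral[OF integrable_lborel] integral_1
    by (simp add: nonneg integral_completion)
  finally show ?thesis .
qed

text \<open>The kernel is bounded, so a multiple of \<open>h\<close> dominates the integrand for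
  every single \<open>t\<close>.\<close>

lemma integrable_convolution_integrand:
  assumes "integrable lebesgue h"
  shows "integrable lebesgue (\<lambda>s. k (t - s) * h s)"
proof -
  obtain B where B: "\<And>x. k x \<le> B" using bounded by metis
  have h: "h \<in> borel_measurable lebesgue" using assms by (rule borel_measurable_integrable)
  have k: "(\<lambda>s. k (t - s)) \<in> borel_measurable lebesgue"
    by (rule measurable_completion) simp
  show ?thesis
  proof (rule Bochner_Integration.integrable_bound[where f = "\<lambda>s. B * h s"])
    show "integrable lebesgue (\<lambda>s. B * h s)" using assms by simp
    show "AE s in lebesgue. norm (k (t - s) * h s) \<le> norm (B * h s)"
    proof (rule AE_I2)
      fix s
      have "\<bar>k (t - s)\<bar> \<le> \<bar>B\<bar>" using B[of "t - s"] nonneg[of "t - s"] by simp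
      then show "norm (k (t - s) * h s) \<le> norm (B * h s)"
        by (simp add: abs_mult mult_right_mono)
    qed
    show "(\<lambda>s. k (t - s) * h s) \<in> borel_measurable lebesgue"
      using k h by (rule borel_measurable_times)
  qed
qed

lemma convolution_diff:
  assumes "integrable lebesgue f" "integrable lebesgue g"
  shows "convolution k (\<lambda>s. f s - g s) t = convolution k f t - convolution k g t"
proof -
  note int = assms[THEN integrable_convolution_integrand, of t]
  have "convolution k (\<lambda>s. f s - g s) t = (LINT s|lebesgue. k (t - s) * f s - k (t - s) * g s)"
    unfolding convolution_def by (simp only: right_diff_distrib)
  then show ?thesis
    unfolding convolution_def by (simp only: Bochner_Integration.integral_diff[OF int])
qed

text \<open>The convolution at \<open>t\<close> is an average of the values of \<open>h\<close>
  within distance \<open>r\<close> of \<open>t\<close>. The case \<open>c = 0\<close> gives uniform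
  bounds, and \<open>c = g t\<close> gives convergence at points of continuity of
  \<open>g\<close>.\<close>

lemma convolution_near:
  assumes h: "integrable lebesgue h"
    and near: "AE s in lebesgue. \<bar>t - s\<bar> \<le> r \<longrightarrow> \<bar>h s - c\<bar> \<le> e"
  shows "\<bar>convolution k h t - c\<bar> \<le> e"
proof -
  have k_int: "integrable lebesgue (\<lambda>s. k (t - s))" "(LINT s|lebesgue. k (t - s)) = 1"
    using translate_integrable[of t] translate_integral[of t]
    by (simp_all add: integrable_completion integral_completion)
  note int = integrable_convolution_integrand[OF h, of t]
  \<comment> \<open>The kernel has mass 1, so \<open>c\<close> equals its own average and can be
    moved under the integral.\<close>
  have "convolution k h t - c = (LINT s|lebesgue. k (t - s) * h s - k (t - s) * c)"
    unfolding convolution_def using int k_int by simp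
  also have "\<bar>\<dots>\<bar> \<le> (LINT s|lebesgue. k (t - s) * e)"
  proof (rule order_trans[OF integral_abs_bound integral_mono_AE])
    show "AE s in lebesgue. \<bar>k (t - s) * h s - k (t - s) * c\<bar> \<le> k (t - s) * e"
      using near
    proof eventually_elim
      case (elim s)
      show ?case
      proof (cases "\<bar>t - s\<bar> \<le> r")
        case True
        then show ?thesis
          using elim nonneg[of "t - s"]
          by (simp add: abs_mult mult_left_mono flip: right_diff_distrib)
      next
        case False
        then show ?thesis by (simp add: support)
      qed
    qed
  qed (use int k_int in auto)
  also have "\<dots> = e" using k_int by simp
  finally show ?thesis .
qed

text \<open>The norm bound is Young's inequality for a kernel of mass 1: take absolute values
  inside, exchange the integrals, and integrate the kernel out. Integrability of the convolution
  follows from the same estimate.\<close>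

lemma
  assumes h: "integrable lebesgue h"
  shows borel_measurable_convolution: "convolution k h \<in> borel_measurable borel"
    and integrable_convolution: "integrable lebesgue (convolution k h)"
    and convolution_L1_le: "(LINT t|lebesgue. \<bar>convolution k h t\<bar>) \<le> (LINT t|lebesgue. \<bar>h t\<bar>)"
proof -
  \<comment> \<open>The exchange of integrals takes place on the product of \<open>lborel\<close>
    with itself. Hence \<open>h\<close> is replaced by a Borel function equal to it almost
    everywhere, which changes no value of the convolution.\<close>
  obtain h' where h': "h' \<in> borel_measurable lborel" and ae: "AE x in lborel. h x = h' x"
    by (rule bexE[OF completion_ex_borel_measurable_real[OF borel_measurable_integrable[OF h]]])
  have [measurable]: "h' \<in> borel_measurable borel" using h' by simp
  have ae': "AE x in lebesgue. h x = h' x" using ae by (rule AE_completion)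
  have h'_int: "integrable lborel h'"
  proof -
    have "integrable lebesgue h'"
      using h measurable_completion[OF h']
      by (rule integrable_cong_AE_imp) (use ae' in eventually_elim, simp)
    then show ?thesis using h' by (simp only: integrable_completion)
  qed
  have conv: "convolution k h t = (LINT s|lborel. k (t - s) * h' s)" for t
  proof -
    have "convolution k h t = (LINT s|lebesgue. k (t - s) * h' s)"
      unfolding convolution_def
    proof (rule integral_cong_AE)
      show "(\<lambda>s. k (t - s) * h s) \<in> borel_measurable lebesgue"
        using integrable_convolution_integrand[OF h] by blast
      show "(\<lambda>s. k (t - s) * h' s) \<in> borel_measurable lebesgue"
        by (rule measurable_completion) simp
    qed (use ae' in auto)
    then show ?thesis by (simp add: integral_completion)
  qed
  show meas[measurable]: "convolution k h \<in> borel_measurable borel"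
    unfolding conv[abs_def] by measurable
  have pointwise: "ennreal \<bar>convolution k h t\<bar> \<le> (\<integral>\<^sup>+s. ennreal (k (t - s)) * ennreal \<bar>h' s\<bar> \<partial>lborel)" for t
  proof -
    \<comment> \<open>For a non-integrable integrand the left side would be 0 by convention, so the
      bound holds in both cases of the split.\<close>
    have "ennreal \<bar>convolution k h t\<bar> \<le> (\<integral>\<^sup>+s. norm (k (t - s) * h' s) \<partial>lborel)"
      unfolding conv using integral_norm_bound_ennreal[of lborel "\<lambda>s. k (t - s) * h' s"]
        integrable_convolution_integrand[OF h, of t]
      by (cases "integrable lborel (\<lambda>s. k (t - s) * h' s)") (auto simp: not_integrable_integral_eq)
    also have "\<dots> = (\<integral>\<^sup>+s. ennreal (k (t - s)) * ennreal \<bar>h' s\<bar> \<partial>lborel)"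
      by (intro nn_integral_cong) (simp add: abs_mult ennreal_mult nonneg)
    finally show ?thesis .
  qed
  have "(\<integral>\<^sup>+t. ennreal \<bar>convolution k h t\<bar> \<partial>lborel)
      \<le> (\<integral>\<^sup>+t. (\<integral>\<^sup>+s. ennreal (k (t - s)) * ennreal \<bar>h' s\<bar> \<partial>lborel) \<partial>lborel)"
    by (intro nn_integral_mono pointwise)
  also have "\<dots> = (\<integral>\<^sup>+s. (\<integral>\<^sup>+t. ennreal (k (t - s)) * ennreal \<bar>h' s\<bar> \<partial>lborel) \<partial>lborel)"
    by (rule lborel_pair.Fubini') measurable
  also have "\<dots> = (\<integral>\<^sup>+s. ennreal \<bar>h' s\<bar> \<partial>lborel)"
    by (simp add: nn_integral_multc translate_nn_integral)
  finally have young: "(\<integral>\<^sup>+t. ennreal \<bar>convolution k h t\<bar> \<partial>lborel) \<le> (\<integral>\<^sup>+s. ennreal \<bar>h' s\<bar> \<partial>lborel)" .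
  have fin: "(\<integral>\<^sup>+s. ennreal \<bar>h' s\<bar> \<partial>lborel) < \<infinity>"
    using h'_int by (simp add: integrable_iff_bounded)
  have int: "integrable lborel (convolution k h)"
    using young fin by (auto simp: integrable_iff_bounded intro: le_less_trans)
  then show "integrable lebesgue (convolution k h)"
    by (simp add: integrable_completion)
  have "(LINT t|lborel. \<bar>convolution k h t\<bar>) \<le> (LINT t|lborel. \<bar>h' t\<bar>)"
    using young fin by (auto simp: integral_eq_nn_integral intro!: enn2real_mono)
  moreover have "(LINT t|lebesgue. \<bar>h t\<bar>) = (LINT t|lebesgue. \<bar>h' t\<bar>)"
    using ae' h measurable_completion[OF h'] by (intro integral_cong_AE) auto
  ultimately show "(LINT t|lebesgue. \<bar>convolution k h t\<bar>) \<le> (LINT t|lebesgue. \<bar>h t\<bar>)"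
    by (simp add: integral_completion)
qed

end

section \<open>Zero extension and the \<open>L\<^sup>1\<close> distance\<close>

lemma integrable_lebesgue_on:
  fixes f :: "real \<Rightarrow> real"
  assumes "integrable lebesgue f"
  shows "integrable (lebesgue_on {a<..<b}) f"
  using integrable_mult_indicator[OF _ assms, of "{a<..<b}"] by (simp add: integrable_restrict_space)

text \<open>The extension keeps the values of \<open>w\<close> at 0 and \<open>T\<close>, whereas
  \<open>L1\<close> controls \<open>w\<close> only on the open interval. The endpoints are split off
  as multiples of indicators of null sets.\<close>

lemma zero_extension_eq:
  assumes "T > 0"
  shows "zero_extension T w = (\<lambda>t. indicator {0<..<T} t * w t + (indicator {0} t * w 0 + indicator {T} t * w T))"
  using assms by (auto simp: zero_extension_def fun_eq_iff indicator_def)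

lemma integrable_zero_extension:
  assumes "T > 0" and "w \<in> L1 T"
  shows "integrable lebesgue (zero_extension T w)"
proof -
  have "integrable lebesgue (\<lambda>t. indicator {0<..<T} t * w t)"
    using assms(2) by (simp add: L1_def integrable_restrict_space)
  moreover have "integrable lebesgue (\<lambda>t. indicator {a} t * c)" for a c :: real
    by (intro integrable_mult_left integrable_real_indicator) auto
  ultimately show ?thesis
    unfolding zero_extension_eq[OF assms(1)] by (intro Bochner_Integration.integrable_add)
qed

lemma L1_dist_zero_extension:
  assumes "T > 0" and "w \<in> L1 T" and "v \<in> L1 T"
  shows "(LINT t|lebesgue. \<bar>zero_extension T w t - zero_extension T v t\<bar>) = L1_dist T w v"
proof -
  have "(LINT t|lebesgue. \<bar>zero_extension T w t - zero_extension T v t\<bar>)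
      = (LINT t|lebesgue. indicator {0<..<T} t *\<^sub>R \<bar>w t - v t\<bar>)"
  proof (rule integral_cong_AE)
    show "(\<lambda>t. \<bar>zero_extension T w t - zero_extension T v t\<bar>) \<in> borel_measurable lebesgue"
      using integrable_zero_extension[OF assms(1)] assms(2,3) by simp
    show "(\<lambda>t. indicator {0<..<T} t *\<^sub>R \<bar>w t - v t\<bar>) \<in> borel_measurable lebesgue"
      using assms(2,3) unfolding L1_def
      by (intro borel_measurable_restrict_space_iff[THEN iffD1]) auto
    have "AE t in lebesgue. t \<noteq> a" for a :: real
      by (rule AE_completion) (rule AE_lborel_singleton)
    from this[of 0] this[of T]
    show "AE t in lebesgue. \<bar>zero_extension T w t - zero_extension T v t\<bar>
        = indicator {0<..<T} t *\<^sub>R \<bar>w t - v t\<bar>"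
      by eventually_elim (auto simp: zero_extension_def indicator_def)
  qed
  also have "\<dots> = L1_dist T w v"
    unfolding L1_dist_def by (subst integral_restrict_space) auto
  finally show ?thesis .
qed

lemma L1_dist_nonneg: "0 \<le> L1_dist T f g"
  unfolding L1_dist_def by simp

lemma L1_dist_commute: "L1_dist T f g = L1_dist T g f"
  unfolding L1_dist_def by (simp add: abs_minus_commute)

lemma L1_dist_triangle:
  assumes "f \<in> L1 T" "g \<in> L1 T" "h \<in> L1 T"
  shows "L1_dist T f h \<le> L1_dist T f g + L1_dist T g h"
proof -
  have "L1_dist T f h \<le> (LINT t|lebesgue_on {0<..<T}. \<bar>f t - g t\<bar> + \<bar>g t - h t\<bar>)"
    unfolding L1_dist_def using assms by (intro integral_mono) (auto simp: L1_def)
  also have "\<dots> = L1_dist T f g + L1_dist T g h"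
    unfolding L1_dist_def using assms by (intro Bochner_Integration.integral_add) (auto simp: L1_def)
  finally show ?thesis .
qed

section \<open>Bounded functions on the interval and their continuous approximation\<close>

lemma finite_measure_lebesgue_on_Ioo: "finite_measure (lebesgue_on {a<..<b::real})"
  by (rule finite_measure_lebesgue_on) simp

lemma AE_lebesgue_on_Ioo: "AE t in lebesgue_on {a<..<b::real}. t \<in> {a<..<b}"
  by (rule AE_I2) (simp add: space_restrict_space)

lemma measurable_bounded_in_L1:
  assumes "f \<in> borel_measurable (lebesgue_on {0<..<T})"
    and "AE t in lebesgue_on {0<..<T}. \<bar>f t\<bar> \<le> M"
  shows "f \<in> L1 T"
  unfolding L1_def using assms
  by (auto intro!: finite_measure.integrable_const_bound[OF finite_measure_lebesgue_on_Ioo])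

lemma measurable_bounded_in_L2:
  assumes "f \<in> borel_measurable (lebesgue_on {0<..<T})"
    and "AE t in lebesgue_on {0<..<T}. \<bar>f t\<bar> \<le> M"
  shows "f \<in> L2 T"
proof -
  have "integrable (lebesgue_on {0<..<T}) (\<lambda>t. (f t)\<^sup>2)"
  proof (rule finite_measure.integrable_const_bound[OF finite_measure_lebesgue_on_Ioo])
    show "AE t in lebesgue_on {0<..<T}. norm ((f t)\<^sup>2) \<le> M\<^sup>2"
      using assms(2) by eventually_elim (simp add: abs_le_square_iff[symmetric])
  qed (use assms(1) in measurable)
  then show ?thesis using assms(1) by (simp add: L2_def)
qed

lemma continuous_measurable_lebesgue_on:
  assumes "continuous_on UNIV (g :: real \<Rightarrow> real)"
  shows "g \<in> borel_measurable (lebesgue_on {a<..<b})"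
  by (intro continuous_imp_measurable_on_sets_lebesgue continuous_on_subset[OF assms]) auto

text \<open>Since the interval has finite measure, the constant \<open>B\<close> is an integrable
  majorant.\<close>

lemma L1_dist_tendsto_dominated:
  assumes "\<And>n. f n \<in> borel_measurable (lebesgue_on {0<..<T})"
    and "g \<in> borel_measurable (lebesgue_on {0<..<T})"
    and "AE t in lebesgue_on {0<..<T}. (\<lambda>n. f n t) \<longlonglongrightarrow> g t"
    and "\<And>n. AE t in lebesgue_on {0<..<T}. \<bar>f n t - g t\<bar> \<le> B"
  shows "(\<lambda>n. L1_dist T (f n) g) \<longlonglongrightarrow> 0"
proof -
  have "(\<lambda>n. LINT t|lebesgue_on {0<..<T}. \<bar>f n t - g t\<bar>) \<longlonglongrightarrow> (LINT t|lebesgue_on {0<..<T}. 0)"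
  proof (rule integral_dominated_convergence[where w = "\<lambda>_. B"])
    show "AE t in lebesgue_on {0<..<T}. (\<lambda>n. \<bar>f n t - g t\<bar>) \<longlonglongrightarrow> 0"
      using assms(3)
    proof eventually_elim
      case (elim t)
      then have "(\<lambda>n. \<bar>f n t - g t\<bar>) \<longlonglongrightarrow> \<bar>g t - g t\<bar>" by (intro tendsto_intros)
      then show ?case by simp
    qed
    show "AE t in lebesgue_on {0<..<T}. norm \<bar>f n t - g t\<bar> \<le> B" for n
      using assms(4)[of n] by simp
    show "integrable (lebesgue_on {0<..<T}) (\<lambda>_. B)"
      using finite_measure_lebesgue_on_Ioo by (rule finite_measure.integrable_const)
  qed (use assms(1,2) in measurable)
  then show ?thesis by (simp add: L1_dist_def)
qed

text \<open>A measurable function is an almost everywhere limit of continuous ones. Once these are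
  truncated at height \<open>M\<close>, dominated convergence turns the pointwise limit into an
  \<open>L\<^sup>1\<close> limit.\<close>

lemma bounded_approx_continuous_L1:
  assumes w: "w \<in> borel_measurable (lebesgue_on {0<..<T})"
    and M: "AE t in lebesgue_on {0<..<T}. \<bar>w t\<bar> \<le> M" "0 \<le> M" and "0 < e"
  obtains g where "continuous_on UNIV g" "\<And>t. \<bar>g t\<bar> \<le> M" "L1_dist T g w < e"
proof -
  have "w measurable_on {0<..<T}"
    using w by (subst measurable_on_iff_borel_measurable) auto
  then obtain N g where N: "negligible N" and g: "\<And>n. continuous_on UNIV (g n)"
    and lim: "\<And>x. x \<notin> N \<Longrightarrow> (\<lambda>n. g n x) \<longlonglongrightarrow> (if x \<in> {0<..<T} then w x else 0)"
    unfolding measurable_on_def by metis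
  \<comment> \<open>Clipping to the range of \<open>w\<close> preserves continuity and the limit,
    and supplies the uniform bound that \<open>g n\<close> may lack.\<close>
  define c where "c n t = max (-M) (min M (g n t))" for n :: nat and t
  have c_cont: "continuous_on UNIV (c n)" for n
    unfolding c_def using g by (intro continuous_intros)
  have c_bound: "\<bar>c n t\<bar> \<le> M" for n t
    using \<open>0 \<le> M\<close> unfolding c_def by linarith
  have "AE t in lebesgue. t \<notin> N"
    using N by (intro AE_not_in) (simp add: negligible_iff_null_sets)
  then have N': "AE t in lebesgue_on {0<..<T}. t \<notin> N"
    by (subst AE_restrict_space_iff) auto
  have "(\<lambda>n. L1_dist T (c n) w) \<longlonglongrightarrow> 0"
  proof (rule L1_dist_tendsto_dominated)
    show "AE t in lebesgue_on {0<..<T}. (\<lambda>n. c n t) \<longlonglongrightarrow> w t"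
      using N' M(1) AE_lebesgue_on_Ioo
    proof eventually_elim
      case (elim t)
      then have "(\<lambda>n. c n t) \<longlonglongrightarrow> max (-M) (min M (w t))"
        unfolding c_def using lim[of t] by (intro tendsto_intros) auto
      moreover have "max (-M) (min M (w t)) = w t" using elim by auto
      ultimately show ?case by simp
    qed
    show "AE t in lebesgue_on {0<..<T}. \<bar>c n t - w t\<bar> \<le> 2 * M" for n
      using M(1)
    proof eventually_elim
      case (elim t)
      then show ?case using c_bound[of n t] by linarith
    qed
  qed (use w c_cont continuous_measurable_lebesgue_on in auto)
  then have "eventually (\<lambda>n. L1_dist T (c n) w < e) sequentially"
    using \<open>0 < e\<close> by (rule order_tendstoD)
  then obtain n where "L1_dist T (c n) w < e"
    by (auto simp: eventually_sequentially)
  then show ?thesis using that c_cont c_bound by blast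
qed

section \<open>\<open>L\<^sup>1\<close> convergence of mollified sequences\<close>

lemma (in averaging_kernel) measurable_convolution_zero_extension:
  assumes "T > 0" and "w \<in> L1 T"
  shows "convolution k (zero_extension T w) \<in> borel_measurable (lebesgue_on {0<..<T})"
  using integrable_convolution[OF integrable_zero_extension[OF assms]]
  by (intro measurable_restrict_space1) simp

lemma (in averaging_kernel) convolution_zero_extension_in_L1:
  assumes "T > 0" and "w \<in> L1 T"
  shows "convolution k (zero_extension T w) \<in> L1 T"
  unfolding L1_def
  using integrable_convolution[OF integrable_zero_extension[OF assms]]
  by (simp add: integrable_lebesgue_on)

text \<open>This is \<open>convolution_near\<close> with \<open>c = 0\<close>. The extension
  satisfies the bound outside the interval because \<open>0 \<le> M\<close>, and the endpoints are
  null.\<close>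

lemma (in averaging_kernel) convolution_zero_extension_bound:
  assumes "T > 0" and "w \<in> L1 T"
    and "AE t in lebesgue_on {0<..<T}. \<bar>w t\<bar> \<le> M" and "0 \<le> M"
  shows "\<bar>convolution k (zero_extension T w) t\<bar> \<le> M"
proof -
  have "AE s in lebesgue. s \<noteq> a" for a :: real
    by (rule AE_completion) (rule AE_lborel_singleton)
  note this[of 0] this[of T]
  moreover have "AE s in lebesgue. s \<in> {0<..<T} \<longrightarrow> \<bar>w s\<bar> \<le> M"
    using assms(3) by (subst (asm) AE_restrict_space_iff) auto
  ultimately have "AE s in lebesgue. \<bar>t - s\<bar> \<le> r \<longrightarrow> \<bar>zero_extension T w s - 0\<bar> \<le> M"
    by eventually_elim (use \<open>0 \<le> M\<close> in \<open>auto simp: zero_extension_def\<close>)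
  from convolution_near[OF integrable_zero_extension[OF assms(1,2)] this]
  show ?thesis by simp
qed

text \<open>By linearity this is Young's inequality for the difference of the extensions. The
  constant 1 is the same for all kernels, so the estimate is uniform along a mollifying
  sequence.\<close>

lemma (in averaging_kernel) L1_dist_convolution_le:
  assumes "T > 0" and "w \<in> L1 T" and "v \<in> L1 T"
  shows "L1_dist T (convolution k (zero_extension T w)) (convolution k (zero_extension T v)) \<le> L1_dist T w v"
proof -
  let ?h = "\<lambda>t. zero_extension T w t - zero_extension T v t"
  note int = assms(2,3)[THEN integrable_zero_extension[OF assms(1)]]
  have h: "integrable lebesgue ?h" using int by simp
  have "L1_dist T (convolution k (zero_extension T w)) (convolution k (zero_extension T v))
      = (LINT t|lebesgue_on {0<..<T}. \<bar>convolution k ?h t\<bar>)"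
    unfolding L1_dist_def convolution_diff[OF int] ..
  also have "\<dots> = (LINT t|lebesgue. indicator {0<..<T} t *\<^sub>R \<bar>convolution k ?h t\<bar>)"
    by (subst integral_restrict_space) auto
  also have "\<dots> \<le> (LINT t|lebesgue. \<bar>convolution k ?h t\<bar>)"
    using integrable_convolution[OF h]
    by (intro integral_mono integrable_mult_indicator) (auto simp: indicator_def)
  also have "\<dots> \<le> (LINT t|lebesgue. \<bar>?h t\<bar>)" by (rule convolution_L1_le[OF h])
  also have "\<dots> = L1_dist T w v" by (rule L1_dist_zero_extension[OF assms])
  finally show ?thesis .
qed

text \<open>The convergence is pointwise at every interior point by continuity of \<open>g\<close>,
  and all differences are bounded by \<open>2 * M\<close>.\<close>

lemma mollified_continuous_tendsto:
  assumes "T > 0" and k: "\<And>n. averaging_kernel (k n) (r n)" and r: "r \<longlonglongrightarrow> 0"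
    and g: "continuous_on UNIV g" "\<And>t. \<bar>g t\<bar> \<le> M"
  shows "(\<lambda>n. L1_dist T (convolution (k n) (zero_extension T g)) g) \<longlonglongrightarrow> 0"
proof (rule L1_dist_tendsto_dominated)
  have M: "0 \<le> M" using g(2)[of 0] by linarith
  have meas: "g \<in> borel_measurable (lebesgue_on {0<..<T})"
    using g(1) by (rule continuous_measurable_lebesgue_on)
  then have L1: "g \<in> L1 T" using g(2) by (intro measurable_bounded_in_L1) auto
  note int = integrable_zero_extension[OF \<open>T > 0\<close> L1]
  show "g \<in> borel_measurable (lebesgue_on {0<..<T})" by (fact meas)
  show "convolution (k n) (zero_extension T g) \<in> borel_measurable (lebesgue_on {0<..<T})" for n
    using averaging_kernel.measurable_convolution_zero_extension[OF k \<open>T > 0\<close> L1] .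
  show "AE t in lebesgue_on {0<..<T}. \<bar>convolution (k n) (zero_extension T g) t - g t\<bar> \<le> 2 * M" for n
  proof (rule AE_I2)
    fix t
    have "\<bar>convolution (k n) (zero_extension T g) t\<bar> \<le> M"
      using g(2) by (intro averaging_kernel.convolution_zero_extension_bound[OF k \<open>T > 0\<close> L1 _ M]) auto
    then show "\<bar>convolution (k n) (zero_extension T g) t - g t\<bar> \<le> 2 * M"
      using g(2)[of t] by linarith
  qed
  show "AE t in lebesgue_on {0<..<T}. (\<lambda>n. convolution (k n) (zero_extension T g) t) \<longlonglongrightarrow> g t"
    using AE_lebesgue_on_Ioo
  proof eventually_elim
    case (elim t)
    show ?case
    proof (rule LIMSEQ_I)
      fix e :: real assume "0 < e"
      have "isCont g t" using g(1) by (simp add: continuous_on_eq_continuous_at)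
      then obtain d where "0 < d" and d: "\<And>s. \<bar>s - t\<bar> < d \<Longrightarrow> \<bar>g s - g t\<bar> < e / 2"
        using \<open>0 < e\<close> unfolding continuous_at_eps_delta dist_real_def by (metis half_gt_zero)
      \<comment> \<open>Radii below \<open>t\<close> and \<open>T - t\<close> keep the averaging
        window inside the interval, where the zero extension agrees with \<open>g\<close>.\<close>
      let ?d = "min d (min t (T - t))"
      have "0 < ?d" using \<open>0 < d\<close> elim by simp
      with r have "eventually (\<lambda>n. r n < ?d) sequentially" by (rule order_tendstoD)
      then obtain n0 where n0: "\<And>n. n \<ge> n0 \<Longrightarrow> r n < ?d" by (auto simp: eventually_sequentially)
      have "\<bar>convolution (k n) (zero_extension T g) t - g t\<bar> \<le> e / 2" if "n \<ge> n0" for n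
      proof (rule averaging_kernel.convolution_near[OF k int], rule AE_I2, rule impI)
        fix s assume "\<bar>t - s\<bar> \<le> r n"
        with n0[OF that] have "\<bar>s - t\<bar> < d" "s \<in> {0..T}" by auto
        then show "\<bar>zero_extension T g s - g t\<bar> \<le> e / 2"
          using d[of s] by (simp add: zero_extension_def)
      qed
      then have "\<forall>n\<ge>n0. norm (convolution (k n) (zero_extension T g) t - g t) < e"
        using \<open>0 < e\<close> by fastforce
      then show "\<exists>n0. \<forall>n\<ge>n0. norm (convolution (k n) (zero_extension T g) t - g t) < e" ..
    qed
  qed
qed

text \<open>Compare with a bounded continuous \<open>g\<close> close to \<open>w\<close>. The
  contraction property carries \<open>u n - g\<close> through the convolution, which leaves the
  distances from \<open>u n\<close> to \<open>w\<close>, from \<open>w\<close> to \<open>g\<close>,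
  from the mollified \<open>g\<close> to \<open>g\<close>, and from \<open>g\<close> to
  \<open>w\<close>. Four terms, hence \<open>e / 4\<close>.\<close>

lemma mollified_sequence_tendsto_L1:
  assumes "T > 0" and k: "\<And>n. averaging_kernel (k n) (r n)" and r: "r \<longlonglongrightarrow> 0"
    and u: "\<And>n. u n \<in> L1 T" and w: "w \<in> L1 T"
    and bound: "AE t in lebesgue_on {0<..<T}. \<bar>w t\<bar> \<le> M" "0 \<le> M"
    and conv: "(\<lambda>n. L1_dist T (u n) w) \<longlonglongrightarrow> 0"
  shows "(\<lambda>n. L1_dist T (convolution (k n) (zero_extension T (u n))) w) \<longlonglongrightarrow> 0"
proof (rule LIMSEQ_I)
  fix e :: real assume "0 < e"
  have wm: "w \<in> borel_measurable (lebesgue_on {0<..<T})" using w by (simp add: L1_def)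
  obtain g where g: "continuous_on UNIV g" "\<And>t. \<bar>g t\<bar> \<le> M" and gw: "L1_dist T g w < e / 4"
    using bounded_approx_continuous_L1[OF wm bound, of "e / 4"] \<open>0 < e\<close> by auto
  have gL1: "g \<in> L1 T"
    using continuous_measurable_lebesgue_on[OF g(1)] g(2) by (intro measurable_bounded_in_L1) auto
  let ?K = "\<lambda>n v. convolution (k n) (zero_extension T v)"
  note K_L1 = averaging_kernel.convolution_zero_extension_in_L1[OF k \<open>T > 0\<close>]
  have "eventually (\<lambda>n. L1_dist T (u n) w < e / 4) sequentially"
    using conv \<open>0 < e\<close> by (intro order_tendstoD) auto
  moreover have "eventually (\<lambda>n. L1_dist T (?K n g) g < e / 4) sequentially"
    using mollified_continuous_tendsto[OF \<open>T > 0\<close> k r g] \<open>0 < e\<close> by (intro order_tendstoD) auto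
  ultimately have "eventually (\<lambda>n. norm (L1_dist T (?K n (u n)) w - 0) < e) sequentially"
  proof eventually_elim
    case (elim n)
    have "L1_dist T (?K n (u n)) w \<le> L1_dist T (?K n (u n)) (?K n g) + L1_dist T (?K n g) w"
      by (intro L1_dist_triangle K_L1 u w gL1)
    also have "L1_dist T (?K n g) w \<le> L1_dist T (?K n g) g + L1_dist T g w"
      by (intro L1_dist_triangle K_L1 w gL1)
    also have "L1_dist T (?K n (u n)) (?K n g) \<le> L1_dist T (u n) g"
      by (intro averaging_kernel.L1_dist_convolution_le[OF k] \<open>T > 0\<close> u gL1)
    also have "L1_dist T (u n) g \<le> L1_dist T (u n) w + L1_dist T w g"
      by (intro L1_dist_triangle u w gL1)
    finally show ?case
      using elim gw L1_dist_commute[of T w g] L1_dist_nonneg[of T "?K n (u n)" w] by simp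
  qed
  then show "\<exists>n0. \<forall>n\<ge>n0. norm (L1_dist T (?K n (u n)) w - 0) < e"
    by (simp only: eventually_sequentially)
qed

section \<open>From \<open>L\<^sup>1\<close> to \<open>L\<^sup>2\<close> convergence\<close>

lemma L2_dist_tendsto_of_L1_dist_tendsto:
  assumes f: "\<And>n. f n \<in> borel_measurable (lebesgue_on {0<..<T})"
    and g: "g \<in> borel_measurable (lebesgue_on {0<..<T})"
    and f_bound: "\<And>n. AE t in lebesgue_on {0<..<T}. \<bar>f n t\<bar> \<le> M"
    and g_bound: "AE t in lebesgue_on {0<..<T}. \<bar>g t\<bar> \<le> M"
    and conv: "(\<lambda>n. L1_dist T (f n) g) \<longlonglongrightarrow> 0"
  shows "(\<lambda>n. L2_dist T (f n) g) \<longlonglongrightarrow> 0"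
proof (rule tendsto_sandwich[of "\<lambda>_. 0"])
  have le: "AE t in lebesgue_on {0<..<T}. (f n t - g t)\<^sup>2 \<le> 2 * M * \<bar>f n t - g t\<bar>" for n
    using f_bound[of n] g_bound
  proof eventually_elim
    case (elim t)
    then have "\<bar>f n t - g t\<bar> \<le> 2 * M" by linarith
    then have "\<bar>f n t - g t\<bar> * \<bar>f n t - g t\<bar> \<le> 2 * M * \<bar>f n t - g t\<bar>"
      by (rule mult_right_mono) simp
    then show ?case by (simp add: power2_eq_square)
  qed
  have "L2_dist T (f n) g \<le> sqrt (2 * M * L1_dist T (f n) g)" for n
  proof -
    have int: "integrable (lebesgue_on {0<..<T}) (\<lambda>t. 2 * M * \<bar>f n t - g t\<bar>)"
      using measurable_bounded_in_L1[OF f f_bound, of n] measurable_bounded_in_L1[OF g g_bound]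
      by (auto simp: L1_def)
    have "(LINT t|lebesgue_on {0<..<T}. (f n t - g t)\<^sup>2) \<le> (LINT t|lebesgue_on {0<..<T}. 2 * M * \<bar>f n t - g t\<bar>)"
    proof (rule integral_mono_AE'[OF int le])
      \<comment> \<open>By \<open>le\<close> the bound dominates a square, which settles its
        sign.\<close>
      show "AE t in lebesgue_on {0<..<T}. 0 \<le> 2 * M * \<bar>f n t - g t\<bar>"
        using le[of n] by eventually_elim (rule order_trans[OF zero_le_power2])
    qed
    then show ?thesis unfolding L2_dist_def L1_dist_def by simp
  qed
  then show "eventually (\<lambda>n. L2_dist T (f n) g \<le> sqrt (2 * M * L1_dist T (f n) g)) sequentially"
    by simp
  have "(\<lambda>n. sqrt (2 * M * L1_dist T (f n) g)) \<longlonglongrightarrow> sqrt (2 * M * 0)"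
    using conv by (intro tendsto_intros)
  then show "(\<lambda>n. sqrt (2 * M * L1_dist T (f n) g)) \<longlonglongrightarrow> 0" by simp
qed (simp_all add: L2_dist_def)

section \<open>Mollifiers as averaging kernels\<close>

lemma averaging_kernel_mollifier:
  assumes "mollifier_kernel \<eta>" and "0 < e"
  shows "averaging_kernel (mollifier \<eta> e) e"
proof
  \<comment> \<open>This is the zeroth iterate in the smoothness condition on the kernel.\<close>
  have diff: "\<eta> differentiable (at x)" for x
    using assms(1) unfolding mollifier_kernel_def by (metis funpow_0)
  then have cont: "continuous_on UNIV \<eta>"
    by (intro continuous_at_imp_continuous_on ballI differentiable_imp_continuous_within)
  have nonneg: "0 \<le> \<eta> x" for x
    using assms(1) by (simp add: mollifier_kernel_def)
  show "continuous_on UNIV (mollifier \<eta> e)"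
    unfolding mollifier_def
    by (intro continuous_intros continuous_on_compose2[OF cont]) (use \<open>0 < e\<close> in auto)
  show "0 \<le> mollifier \<eta> e x" for x
    using nonneg \<open>0 < e\<close> by (simp add: mollifier_def)
  show "mollifier \<eta> e x = 0" if "e < \<bar>x\<bar>" for x
  proof -
    have "x / e \<notin> {-1..1}" using that \<open>0 < e\<close> by (auto simp: field_simps abs_if split: if_splits)
    then have "\<eta> (x / e) = 0"
      using assms(1) closure_subset[of "{x. \<eta> x \<noteq> 0}"] by (auto simp: mollifier_kernel_def fun_support_def)
    then show ?thesis by (simp add: mollifier_def)
  qed
  have [measurable]: "\<eta> \<in> borel_measurable borel"
    using cont by (rule borel_measurable_continuous_onI)
  have "integral\<^sup>L lebesgue (mollifier \<eta> e) = (LINT t|lborel. \<eta> (t / e) / e)"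
    unfolding mollifier_def[abs_def] by (rule integral_completion) measurable
  \<comment> \<open>Substituting \<open>e * t\<close> for \<open>t\<close> produces the factor
    \<open>e\<close>, which cancels the normalisation of the mollifier.\<close>
  also have "\<dots> = e * (LINT t|lborel. \<eta> t / e)"
    using lborel_integral_real_affine[of e "\<lambda>t. \<eta> (t / e) / e" 0] \<open>0 < e\<close> by simp
  also have "\<dots> = integral\<^sup>L lebesgue \<eta>"
    using \<open>0 < e\<close> by (simp add: integral_completion)
  finally show "integral\<^sup>L lebesgue (mollifier \<eta> e) = 1"
    using assms(1) by (simp add: mollifier_kernel_def)
qed

text \<open>\<open>restrict\<close> returns an unspecified value outside the closed interval, so the
  two functions are compared only inside.\<close>

lemma conv_op_eq: "t \<in> {0<..<T} \<Longrightarrow> conv_op \<eta> T e w t = convolution (mollifier \<eta> e) (zero_extension T w) t"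
  by (simp add: conv_op_def)

section \<open>Lower semicontinuity of the total variation\<close>

lemma test_function_deriv_bounded:
  assumes "\<phi> \<in> test_functions T"
  obtains B where "continuous_on UNIV (deriv \<phi>)" "\<And>t. t \<in> {0<..<T} \<Longrightarrow> \<bar>deriv \<phi> t\<bar> \<le> B"
proof -
  obtain D where D: "\<And>x. (\<phi> has_vector_derivative D x) (at x)" "continuous_on UNIV D"
    using assms unfolding test_functions_def C1_differentiable_on_def by auto
  have "deriv \<phi> = D"
    using D(1) by (auto simp: fun_eq_iff has_real_derivative_iff_has_vector_derivative intro!: DERIV_imp_deriv)
  then have cont: "continuous_on UNIV (deriv \<phi>)" using D(2) by simp
  then have "continuous_on {0..T} (deriv \<phi>)"
    by (rule continuous_on_subset) simp
  then have "bounded (deriv \<phi> ` {0..T})"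
    by (intro compact_imp_bounded compact_continuous_image compact_Icc)
  then obtain B where "\<forall>t\<in>{0..T}. norm (deriv \<phi> t) \<le> B"
    by (auto simp: bounded_iff)
  then have "\<bar>deriv \<phi> t\<bar> \<le> B" if "t \<in> {0<..<T}" for t
    using that by simp
  with cont show ?thesis by (rule that)
qed

text \<open>The two pairings differ by at most \<open>B\<close> times the \<open>L\<^sup>1\<close>
  distance.\<close>

lemma pairing_tendsto:
  assumes u: "\<And>n. u n \<in> L1 T" and w: "w \<in> L1 T"
    and conv: "(\<lambda>n. L1_dist T (u n) w) \<longlonglongrightarrow> 0"
    and d: "d \<in> borel_measurable (lebesgue_on {0<..<T})" "\<And>t. t \<in> {0<..<T} \<Longrightarrow> \<bar>d t\<bar> \<le> B"
  shows "(\<lambda>n. LINT t|lebesgue_on {0<..<T}. u n t * d t) \<longlonglongrightarrow> (LINT t|lebesgue_on {0<..<T}. w t * d t)"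
proof -
  have d_bound: "AE t in lebesgue_on {0<..<T}. \<bar>d t\<bar> \<le> B"
    using AE_lebesgue_on_Ioo by eventually_elim (rule d(2))
  have int: "integrable (lebesgue_on {0<..<T}) (\<lambda>t. f t * d t)" if "f \<in> L1 T" for f
  proof (rule Bochner_Integration.integrable_bound[where f = "\<lambda>t. B * f t"])
    show "AE t in lebesgue_on {0<..<T}. norm (f t * d t) \<le> norm (B * f t)"
      using d_bound
    proof eventually_elim
      case (elim t)
      then have "\<bar>d t\<bar> \<le> \<bar>B\<bar>" by linarith
      then have "\<bar>d t\<bar> * \<bar>f t\<bar> \<le> \<bar>B\<bar> * \<bar>f t\<bar>" by (rule mult_right_mono) simp
      then show ?case by (simp add: abs_mult mult.commute)
    qed
  qed (use that d(1) in \<open>auto simp: L1_def intro!: borel_measurable_times\<close>)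
  have "(\<lambda>n. (LINT t|lebesgue_on {0<..<T}. u n t * d t) - (LINT t|lebesgue_on {0<..<T}. w t * d t)) \<longlonglongrightarrow> 0"
  proof (rule Lim_null_comparison)
    show "eventually (\<lambda>n. norm ((LINT t|lebesgue_on {0<..<T}. u n t * d t) - (LINT t|lebesgue_on {0<..<T}. w t * d t))
        \<le> B * L1_dist T (u n) w) sequentially"
    proof (rule always_eventually, rule allI)
      fix n
      have "(LINT t|lebesgue_on {0<..<T}. u n t * d t) - (LINT t|lebesgue_on {0<..<T}. w t * d t)
          = (LINT t|lebesgue_on {0<..<T}. u n t * d t - w t * d t)"
        using int[OF u] int[OF w] by (rule Bochner_Integration.integral_diff[symmetric])
      also have "\<bar>\<dots>\<bar> \<le> (LINT t|lebesgue_on {0<..<T}. B * \<bar>u n t - w t\<bar>)"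
      proof (rule order_trans[OF integral_abs_bound integral_mono_AE])
        show "AE t in lebesgue_on {0<..<T}. \<bar>u n t * d t - w t * d t\<bar> \<le> B * \<bar>u n t - w t\<bar>"
          using d_bound
        proof eventually_elim
          case (elim t)
          have "\<bar>u n t * d t - w t * d t\<bar> = \<bar>d t\<bar> * \<bar>u n t - w t\<bar>"
            by (simp add: algebra_simps flip: abs_mult)
          also have "\<dots> \<le> B * \<bar>u n t - w t\<bar>" using elim by (rule mult_right_mono) simp
          finally show ?case .
        qed
      qed (use int[OF u] int[OF w] u[of n] w in \<open>auto simp: L1_def\<close>)
      also have "\<dots> = B * L1_dist T (u n) w" by (simp add: L1_dist_def)
      finally show "norm ((LINT t|lebesgue_on {0<..<T}. u n t * d t) - (LINT t|lebesgue_on {0<..<T}. w t * d t))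
        \<le> B * L1_dist T (u n) w" by simp
    qed
    show "(\<lambda>n. B * L1_dist T (u n) w) \<longlonglongrightarrow> 0"
      using tendsto_mult_right_zero[OF conv] .
  qed
  then show ?thesis by (rule LIM_zero_cancel)
qed

text \<open>\<open>TV\<close> is a supremum of functionals, each continuous in
  \<open>L\<^sup>1\<close> because the derivative of a test function is bounded. Each pairing with
  \<open>u n\<close> lies below \<open>TV T (u n)\<close>, and this survives in the lower
  limit.\<close>

lemma TV_lower_semicontinuous:
  assumes u: "\<And>n. u n \<in> L1 T" and w: "w \<in> L1 T"
    and conv: "(\<lambda>n. L1_dist T (u n) w) \<longlonglongrightarrow> 0"
  shows "TV T w \<le> liminf (\<lambda>n. TV T (u n))"
  unfolding TV_def[of T w]
proof (rule SUP_least)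
  fix \<phi> assume \<phi>: "\<phi> \<in> {\<phi> \<in> test_functions T. \<forall>s\<in>{0<..<T}. \<bar>\<phi> s\<bar> \<le> 1}"
  then obtain B where B: "continuous_on UNIV (deriv \<phi>)" "\<And>t. t \<in> {0<..<T} \<Longrightarrow> \<bar>deriv \<phi> t\<bar> \<le> B"
    using test_function_deriv_bounded[of \<phi> T] by auto
  let ?I = "\<lambda>v. ereal (LINT t|lebesgue_on {0<..<T}. v t * deriv \<phi> t)"
  have "(\<lambda>n. ?I (u n)) \<longlonglongrightarrow> ?I w"
    using pairing_tendsto[OF u w conv continuous_measurable_lebesgue_on[OF B(1)] B(2)]
    by (rule tendsto_ereal)
  then have "?I w = liminf (\<lambda>n. ?I (u n))"
    by (intro lim_imp_Liminf[symmetric]) auto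
  also have "\<dots> \<le> liminf (\<lambda>n. TV T (u n))"
    unfolding TV_def using \<phi> by (intro Liminf_mono always_eventually allI SUP_upper)
  finally show "?I w \<le> liminf (\<lambda>n. TV T (u n))" .
qed

section \<open>Convergence of the regularized functionals\<close>

lemma BV_in_bounded:
  assumes "finite W"
  obtains M :: real where "0 \<le> M"
    and "\<And>w. w \<in> BV_in W T \<Longrightarrow> AE t in lebesgue_on {0<..<T}. \<bar>w t\<bar> \<le> M"
proof -
  obtain M where M: "\<forall>x\<in>real_of_int ` W. norm x \<le> M"
    using finite_imp_bounded[OF finite_imageI[OF assms, of real_of_int]] by (auto simp: bounded_iff)
  \<comment> \<open>For empty \<open>W\<close> the constant \<open>M\<close> may be negative, hence
    the maximum with 0.\<close>
  have "AE t in lebesgue_on {0<..<T}. \<bar>w t\<bar> \<le> max M 0" if "w \<in> BV_in W T" for w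
  proof -
    have "AE t in lebesgue_on {0..T}. w t \<in> real_of_int ` W"
      using that by (simp add: BV_in_def)
    then have "AE t in lebesgue. t \<in> {0..T} \<longrightarrow> w t \<in> real_of_int ` W"
      by (subst (asm) AE_restrict_space_iff) auto
    then have "AE t in lebesgue. t \<in> {0<..<T} \<longrightarrow> \<bar>w t\<bar> \<le> max M 0"
      by eventually_elim (use M in fastforce)
    then show ?thesis by (subst AE_restrict_space_iff) auto
  qed
  then show ?thesis by (intro that[of "max M 0"]) auto
qed

text \<open>The mollified functions share the bound \<open>M\<close> with the elements of
  \<open>BV_in W T\<close>. Their \<open>L\<^sup>1\<close> convergence therefore upgrades to
  \<open>L\<^sup>2\<close>, where \<open>j\<close> is continuous at \<open>w\<close>.\<close>

lemma regularized_functional_tendsto: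
  assumes "T > 0" and "finite W" and j: "continuous_on_L2 T j" and \<eta>: "mollifier_kernel \<eta>"
    and \<epsilon>: "\<And>n. \<epsilon> n > 0" "\<epsilon> \<longlonglongrightarrow> 0"
    and u: "\<And>n. u n \<in> BV_in W T" and w: "w \<in> BV_in W T"
    and conv: "(\<lambda>n. L1_dist T (u n) w) \<longlonglongrightarrow> 0"
  shows "(\<lambda>n. j (conv_op \<eta> T (\<epsilon> n) (u n))) \<longlonglongrightarrow> j w"
proof -
  obtain M :: real where M: "0 \<le> M"
    and bound: "\<And>w. w \<in> BV_in W T \<Longrightarrow> AE t in lebesgue_on {0<..<T}. \<bar>w t\<bar> \<le> M"
    using BV_in_bounded[OF \<open>finite W\<close>] by metis
  have L1: "v \<in> L1 T" if "v \<in> BV_in W T" for v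
    using that by (simp add: BV_in_def BV_def)
  note k = averaging_kernel_mollifier[OF \<eta> \<epsilon>(1)]
  let ?c = "\<lambda>n. convolution (mollifier \<eta> (\<epsilon> n)) (zero_extension T (u n))"
  let ?K = "\<lambda>n. conv_op \<eta> T (\<epsilon> n) (u n)"
  have K_eq: "t \<in> space (lebesgue_on {0<..<T}) \<Longrightarrow> ?K n t = ?c n t" for n t
    by (simp add: conv_op_eq space_restrict_space)
  have K_meas: "?K n \<in> borel_measurable (lebesgue_on {0<..<T})" for n
    using averaging_kernel.measurable_convolution_zero_extension[OF k \<open>T > 0\<close> L1[OF u], of n n]
    by (subst measurable_cong[OF K_eq])
  have K_bound: "AE t in lebesgue_on {0<..<T}. \<bar>?K n t\<bar> \<le> M" for n
    using averaging_kernel.convolution_zero_extension_bound[OF k \<open>T > 0\<close> L1[OF u] bound[OF u] M]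
    by (intro AE_I2) (simp only: K_eq)
  have w_meas: "w \<in> borel_measurable (lebesgue_on {0<..<T})"
    using L1[OF w] by (simp add: L1_def)
  have "L1_dist T (?K n) w = L1_dist T (?c n) w" for n
    unfolding L1_dist_def by (intro Bochner_Integration.integral_cong) (simp_all only: K_eq)
  then have "(\<lambda>n. L1_dist T (?K n) w) \<longlonglongrightarrow> 0"
    using mollified_sequence_tendsto_L1[OF \<open>T > 0\<close> k \<epsilon>(2) L1[OF u] L1[OF w] bound[OF w] M conv] by simp
  then have L2: "(\<lambda>n. L2_dist T (?K n) w) \<longlonglongrightarrow> 0"
    by (rule L2_dist_tendsto_of_L1_dist_tendsto[OF K_meas w_meas K_bound bound[OF w]])
  show ?thesis
  proof (rule LIMSEQ_I)
    fix e :: real assume "0 < e"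
    have "w \<in> L2 T" by (rule measurable_bounded_in_L2[OF w_meas bound[OF w]])
    then obtain d where "0 < d" and d: "\<And>g. g \<in> L2 T \<Longrightarrow> L2_dist T g w < d \<Longrightarrow> \<bar>j g - j w\<bar> < e"
      using j \<open>0 < e\<close> unfolding continuous_on_L2_def by meson
    from L2 \<open>0 < d\<close> have "eventually (\<lambda>n. L2_dist T (?K n) w < d) sequentially"
      by (rule order_tendstoD)
    then have "eventually (\<lambda>n. norm (j (?K n) - j w) < e) sequentially"
      by eventually_elim (simp add: d measurable_bounded_in_L2[OF K_meas K_bound])
    then show "\<exists>n0. \<forall>n\<ge>n0. norm (j (?K n) - j w) < e"
      by (simp only: eventually_sequentially)
  qed
qed

lemma regularized_liminf:
  assumes "T > 0" and "0 < \<alpha>" and W: "finite W" and j: "continuous_on_L2 T j"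
    and \<eta>: "mollifier_kernel \<eta>" and \<epsilon>: "\<And>n. \<epsilon> n > 0" "\<epsilon> \<longlonglongrightarrow> 0"
    and u: "\<And>n. u n \<in> BV_in W T" and w: "w \<in> BV_in W T"
    and conv: "(\<lambda>n. L1_dist T (u n) w) \<longlonglongrightarrow> 0"
  shows "TV_regularized T \<alpha> j w \<le> liminf (\<lambda>n. TV_regularized T \<alpha> (j \<circ> conv_op \<eta> T (\<epsilon> n)) (u n))"
proof -
  have "TV T w \<le> liminf (\<lambda>n. TV T (u n))"
    using u w by (intro TV_lower_semicontinuous conv) (auto simp: BV_in_def BV_def)
  then have "ereal \<alpha> * TV T w \<le> ereal \<alpha> * liminf (\<lambda>n. TV T (u n))"
    using \<open>0 < \<alpha>\<close> by (intro ereal_mult_left_mono) auto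
  also have "\<dots> = liminf (\<lambda>n. ereal \<alpha> * TV T (u n))"
    using \<open>0 < \<alpha>\<close> by (intro ereal_liminf_lim_mult[symmetric]) auto
  finally have "ereal (j w) + ereal \<alpha> * TV T w \<le> ereal (j w) + liminf (\<lambda>n. ereal \<alpha> * TV T (u n))"
    by (rule add_left_mono)
  \<comment> \<open>The \<open>j\<close>-terms have a finite limit, so the lower limit is additive
    here although it is only superadditive in general.\<close>
  also have "\<dots> = liminf (\<lambda>n. ereal (j (conv_op \<eta> T (\<epsilon> n) (u n))) + ereal \<alpha> * TV T (u n))"
    using regularized_functional_tendsto[OF \<open>T > 0\<close> W j \<eta> \<epsilon> u w conv]
    by (intro ereal_liminf_lim_add[symmetric] tendsto_ereal) auto
  finally show ?thesis by (simp add: TV_regularized_def)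
qed

text \<open>Along a constant sequence the variation term is fixed and the \<open>j\<close>-term
  converges, so the upper bound is attained with equality.\<close>

lemma regularized_limsup_const:
  assumes "T > 0" and W: "finite W" and j: "continuous_on_L2 T j"
    and \<eta>: "mollifier_kernel \<eta>" and \<epsilon>: "\<And>n. \<epsilon> n > 0" "\<epsilon> \<longlonglongrightarrow> 0"
    and w: "w \<in> BV_in W T"
  shows "limsup (\<lambda>n. TV_regularized T \<alpha> (j \<circ> conv_op \<eta> T (\<epsilon> n)) w) = TV_regularized T \<alpha> j w"
proof -
  have "(\<lambda>n. L1_dist T w w) \<longlonglongrightarrow> 0" by (simp add: L1_dist_def)
  from regularized_functional_tendsto[OF \<open>T > 0\<close> W j \<eta> \<epsilon> w w this]
  have "limsup (\<lambda>n. ereal (j (conv_op \<eta> T (\<epsilon> n) w)) + ereal \<alpha> * TV T w)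
      = ereal (j w) + limsup (\<lambda>n. ereal \<alpha> * TV T w)"
    by (intro ereal_limsup_lim_add tendsto_ereal) auto
  then show ?thesis by (simp add: TV_regularized_def Limsup_const)
qed

lemma strict_conv_const:
  assumes "w \<in> BV T"
  shows "strict_conv T (\<lambda>_. w) w"
  using assms by (simp add: strict_conv_def weak_star_conv_def L1_dist_def Limsup_const BV_def)

theorem theorem4p8:
  fixes T \<alpha> :: real
    and W :: "int set"
    and j :: "(real \<Rightarrow> real) \<Rightarrow> real"
    and \<eta> :: "real \<Rightarrow> real"
    and \<epsilon> :: "nat \<Rightarrow> real"
  assumes "T > 0" and "\<alpha> > 0"
    and "finite W"
    and "continuous_on_L2 T j"
    and "mollifier_kernel \<eta>"
    and "\<And>n. \<epsilon> n > 0" and "\<epsilon> \<longlonglongrightarrow> 0"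
  shows "Gamma_converges_on (BV_in W T) (weak_star_conv T)
           (\<lambda>n. TV_regularized T \<alpha> (j \<circ> conv_op \<eta> T (\<epsilon> n))) (TV_regularized T \<alpha> j)
       \<and> Gamma_converges_on (BV_in W T) (strict_conv T)
           (\<lambda>n. TV_regularized T \<alpha> (j \<circ> conv_op \<eta> T (\<epsilon> n))) (TV_regularized T \<alpha> j)"
proof -
  let ?F = "\<lambda>n. TV_regularized T \<alpha> (j \<circ> conv_op \<eta> T (\<epsilon> n))"
  have lower: "TV_regularized T \<alpha> j w \<le> liminf (\<lambda>n. ?F n (u n))"
    if "w \<in> BV_in W T" "\<forall>n. u n \<in> BV_in W T" "weak_star_conv T u w" for u w
    using that by (intro regularized_liminf[OF assms]) (auto simp: weak_star_conv_def)
  have upper: "\<exists>u. (\<forall>n. u n \<in> BV_in W T) \<and> strict_conv T u w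
      \<and> limsup (\<lambda>n. ?F n (u n)) \<le> TV_regularized T \<alpha> j w" if "w \<in> BV_in W T" for w
    using that regularized_limsup_const[OF assms(1,3-7) that] strict_conv_const[of w T]
    by (intro exI[of _ "\<lambda>_. w"]) (auto simp: BV_in_def)
  \<comment> \<open>Strict convergence is the stronger notion. The lower bound along weak-star
    sequences thus covers strict ones, and a strict recovery sequence also serves for weak-star
    convergence.\<close>
  have weak: "strict_conv T u w \<Longrightarrow> weak_star_conv T u w" for u w
    by (simp add: strict_conv_def)
  show ?thesis
    unfolding Gamma_converges_on_def using lower upper weak by meson
qed

end
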